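(* For $n\in\mathbb N_0$, the quantity $$\sum_{\lambda\in \mathcal O(n)}\ell_2(\lambda)-\sum_{\lambda\in \mathcal D(n)}\ell_2(\lambda)$$ is non-negative except for $n=2$ and $n=6$, in which case it equals $-1$.
   Context: $\mathbb N_0=\{0,1,2,\dots\}$. A partition $\lambda=(\lambda_1\ge\lambda_2\ge\dots\ge\lambda_\ell)$ of $n$ is a non-increasing sequence of positive integers (parts) with sum $n$; $\ell(\lambda)$ is its number of parts, and we set $\lambda_k=0$ for $k>\ell(\lambda)$. $\mathcal O(n)$ is the set of partitions of $n$ into odd parts, and $\mathcal D(n)$ is the set of partitions of $n$ into distinct parts. $\ell_2(\lambda)$ denotes the number of parts $\lambda_i$ of $\lambda$ ($1\le i\le \ell(\lambda)$) with $\lambda_i-\lambda_{i+1}=2$. *)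

theory Defs
  imports Main
begin

definition partitions :: "nat \<Rightarrow> nat list set" where
  "partitions n = {xs. sorted_wrt (\<ge>) xs \<and> (\<forall>x\<in>set xs. 0 < x) \<and> sum_list xs = n}"

definition odd_partitions :: "nat \<Rightarrow> nat list set" where
  "odd_partitions n = {xs \<in> partitions n. \<forall>x\<in>set xs. odd x}"

definition distinct_partitions :: "nat \<Rightarrow> nat list set" where
  "distinct_partitions n = {xs \<in> partitions n. distinct xs}"

text \<open>Parts are indexed from 0 here, and are 0 beyond the length of the partition.\<close>

definition part :: "nat list \<Rightarrow> nat \<Rightarrow> nat" where
  "part xs i = (if i < length xs then xs ! i else 0)"

text \<open>The index of the last part is included, so a smallest part equal to 2 is counted.
  Truncated subtraction is harmless because the difference is required to be 2.\<close>

definition ell2 :: "nat list \<Rightarrow> nat" where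
  "ell2 xs = card {i. i < length xs \<and> part xs i - part xs (Suc i) = 2}"

lemma finite_partitions: "finite (partitions n)"
proof (rule finite_subset)
  show "partitions n \<subseteq> {xs. set xs \<subseteq> {..n} \<and> length xs \<le> n}"
  proof
    fix xs assume "xs \<in> partitions n"
    then have pos: "\<forall>x\<in>set xs. 0 < x" and n: "sum_list xs = n"
      by (auto simp: partitions_def)
    from pos have "length xs \<le> sum_list xs"
      by (induction xs) auto
    with n show "xs \<in> {xs. set xs \<subseteq> {..n} \<and> length xs \<le> n}"
      by (auto intro: member_le_sum_list)
  qed
  show "finite {xs. set xs \<subseteq> {..n} \<and> length xs \<le> n}"
    by (rule finite_lists_length_le) simp
qed

lemma finite_odd_partitions: "finite (odd_partitions n)"
  and finite_distinct_partitions: "finite (distinct_partitions n)"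
  by (simp_all add: odd_partitions_def distinct_partitions_def finite_partitions)

end

theory Submission
  imports Defs "HOL-Library.Multiset" "HOL-Computational_Algebra.Formal_Power_Series"
begin

text \<open>
  Let \<open>R\<close> be the generating function of partitions into distinct parts greater than 1. Both sums
  of \<open>\<ell>\<^sub>2\<close> have a closed form in terms of \<open>R\<close>, and so has their difference \<open>D\<close>.

  Count pairs of a partition and a gap \<open>(k, k + 2)\<close>, where \<open>k\<close> and \<open>k + 2\<close> are consecutive
  distinct part sizes and \<open>k = 0\<close> stands for a smallest part 2. For odd parts, \<open>k\<close> is odd, and
  removing one part \<open>k\<close> and one part \<open>k + 2\<close> leaves an arbitrary partition into odd parts. Summing
  \<open>X^(2k+2)\<close> over odd \<open>k\<close> gives \<open>X^4 / (1 - X^4)\<close> times the generating function of these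
  partitions, which by Euler's theorem is \<open>(1 + X) R\<close> (\<open>odd_ell2_gf_eq\<close>). For distinct parts, what
  is left has no part \<open>k\<close>, \<open>k + 1\<close> or \<open>k + 2\<close>; the sum over \<open>k\<close> telescopes after multiplication
  by \<open>1 - X^2\<close> and gives \<open>X^2 R / (1 - X^4)\<close> (\<open>distinct_ell2_gf_eq\<close>). Hence
  \<open>(1 - X^4) D = X^2 (X^2 (1 + X) R - R)\<close>.

  Euler's theorem also shows that \<open>R\<close> counts partitions, with repetition, into parts 2, 3, 5, 7, 9
  and so on. So \<open>W = (1 - X^2) (1 - X^3) R\<close> counts partitions into odd parts at least 5, and
  expanding this product turns the equation above into \<open>(1 - X^4) D = X^2 (X^5 R - W)\<close>
  (\<open>ell2_difference_gf_eq\<close>). In positive degree the coefficients of \<open>X^5 R - W\<close> are non-negative: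
  replacing one odd part \<open>s \<ge> 5\<close> by \<open>(s - 5) / 2\<close> parts 2 is injective, because the number of
  twos reveals \<open>s\<close> (\<open>multi_gf_odd_ge_5_le\<close>).

  The constant coefficient of \<open>X^5 R - W\<close> is \<open>-1\<close>, from the empty partition. In \<open>D\<close> it
  contributes \<open>-1\<close> in degrees 2, 6, 10 and so on; the coefficient of degree 4 vanishes and that of
  degree 8 is positive, so the deficit persists in degree 6 and is cancelled from degree 10 onwards.
\<close>

unbundle fps_syntax

section \<open>Generating functions of weighted classes\<close>

definition weight_gf :: "('a \<Rightarrow> nat) \<Rightarrow> 'a set \<Rightarrow> int fps" where
  "weight_gf w C = Abs_fps (\<lambda>n. int (card {x \<in> C. w x = n}))"

lemma weight_gf_nth: "weight_gf w C $ n = int (card {x \<in> C. w x = n})"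
  by (simp add: weight_gf_def)

lemma weight_gf_Un:
  assumes "\<And>n. finite {x \<in> C. w x = n}" and "\<And>n. finite {x \<in> D. w x = n}" and "C \<inter> D = {}"
  shows "weight_gf w (C \<union> D) = weight_gf w C + weight_gf w D"
proof (rule fps_ext)
  fix n
  have "{x \<in> C \<union> D. w x = n} = {x \<in> C. w x = n} \<union> {x \<in> D. w x = n}"
    by auto
  then have "card {x \<in> C \<union> D. w x = n} = card {x \<in> C. w x = n} + card {x \<in> D. w x = n}"
    using assms by (simp add: card_Un_disjoint disjoint_iff)
  then show "weight_gf w (C \<union> D) $ n = (weight_gf w C + weight_gf w D) $ n"
    by (simp add: weight_gf_nth)
qed

lemma weight_gf_shift:
  assumes bij: "bij_betw g D C" and wt: "\<And>y. y \<in> D \<Longrightarrow> w (g y) = v y + s"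
  shows "weight_gf w C = fps_X ^ s * weight_gf v D"
proof (rule fps_ext)
  fix n
  have C: "C = g ` D"
    using bij by (simp add: bij_betw_def)
  show "weight_gf w C $ n = (fps_X ^ s * weight_gf v D) $ n"
  proof (cases "n < s")
    case True
    then have "{x \<in> C. w x = n} = {}"
      using wt by (auto simp: C)
    with True show ?thesis
      by (simp only: weight_gf_nth fps_X_power_mult_nth card.empty of_nat_0 if_True)
  next
    case False
    have "{x \<in> C. w x = n} = g ` {y \<in> D. v y = n - s}"
      using False wt by (auto simp: C)
    moreover have "inj_on g {y \<in> D. v y = n - s}"
      using bij by (auto simp: bij_betw_def intro: inj_on_subset)
    ultimately have "card {x \<in> C. w x = n} = card {y \<in> D. v y = n - s}"
      by (simp add: card_image)
    with False show ?thesis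
      by (simp add: weight_gf_nth fps_X_power_mult_nth)
  qed
qed

text \<open>Double counting of pairs \<open>(x, k)\<close>. The cut-off \<open>N\<close> replaces an infinite sum of power series by a
  finite one that agrees with it in degree \<open>n\<close>.\<close>

lemma sum_card_eq_weight_gf_nth:
  fixes P :: "nat \<Rightarrow> 'a \<Rightarrow> bool"
  assumes fin: "finite {x \<in> C. w x = n}"
    and bound: "\<And>x k. x \<in> C \<Longrightarrow> w x = n \<Longrightarrow> P k x \<Longrightarrow> k < N"
  shows "(\<Sum>x | x \<in> C \<and> w x = n. int (card {k. P k x})) = (\<Sum>k<N. weight_gf w {x \<in> C. P k x}) $ n"
proof -
  have "(\<Sum>x | x \<in> C \<and> w x = n. int (card {k. P k x}))
      = (\<Sum>x | x \<in> C \<and> w x = n. \<Sum>k<N. if P k x then 1 else 0)"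
  proof (rule sum.cong)
    fix x assume "x \<in> {x. x \<in> C \<and> w x = n}"
    then have "{k. P k x} = {k \<in> {..<N}. P k x}"
      using bound by auto
    then have "int (card {k. P k x}) = (\<Sum>k | k \<in> {..<N} \<and> P k x. 1)"
      by simp
    also have "\<dots> = (\<Sum>k<N. if P k x then 1 else 0)"
      by (rule sum.inter_filter) simp
    finally show "int (card {k. P k x}) = (\<Sum>k<N. if P k x then 1 else 0)" .
  qed simp
  also have "\<dots> = (\<Sum>k<N. \<Sum>x | x \<in> C \<and> w x = n. if P k x then 1 else 0)"
    by (rule sum.swap)
  also have "\<dots> = (\<Sum>k<N. weight_gf w {x \<in> C. P k x} $ n)"
  proof (rule sum.cong)
    fix k
    have "(\<Sum>x | x \<in> C \<and> w x = n. if P k x then 1 else 0)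
        = (\<Sum>x | x \<in> {x. x \<in> C \<and> w x = n} \<and> P k x. 1 :: int)"
      by (rule sum.inter_filter [symmetric]) (use fin in simp)
    also have "{x. x \<in> {x. x \<in> C \<and> w x = n} \<and> P k x} = {x \<in> {x \<in> C. P k x}. w x = n}"
      by auto
    finally show "(\<Sum>x | x \<in> C \<and> w x = n. if P k x then 1 else 0) = weight_gf w {x \<in> C. P k x} $ n"
      by (simp add: weight_gf_nth)
  qed simp
  finally show ?thesis
    by (simp add: fps_sum_nth)
qed

text \<open>The coefficients up to degree \<open>n\<close> of a product depend only on those of the factors, so
  identities for finite sets of parts or finite partial sums pass to the infinite ones.\<close>

lemma fps_mult_nth_cong:
  fixes f f' g g' :: "'a :: comm_semiring_0 fps"
  assumes "\<And>i. i \<le> n \<Longrightarrow> f $ i = f' $ i" and "\<And>i. i \<le> n \<Longrightarrow> g $ i = g' $ i"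
  shows "(f * g) $ n = (f' * g') $ n"
  unfolding fps_mult_nth by (rule sum.cong) (use assms in auto)

lemma one_minus_fps_X_power_nonzero: "k > 0 \<Longrightarrow> (1 - fps_X ^ k :: int fps) \<noteq> 0"
proof
  assume "k > 0" "(1 - fps_X ^ k :: int fps) = 0"
  then have "(1 - fps_X ^ k :: int fps) $ 0 = 0"
    by simp
  with \<open>k > 0\<close> show False
    by (simp add: fps_X_power_nth)
qed

section \<open>Partitions into distinct parts and partitions with repetition\<close>

definition distinct_gf :: "nat set \<Rightarrow> int fps" where
  "distinct_gf A = weight_gf (\<lambda>S. \<Sum>S) {S. finite S \<and> S \<subseteq> A}"

definition multi_gf :: "nat set \<Rightarrow> int fps" where
  "multi_gf A = weight_gf sum_mset {M. set_mset M \<subseteq> A}"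

lemma finite_sets_of_sum:
  assumes "\<And>S. S \<in> C \<Longrightarrow> finite S"
  shows "finite {S \<in> C. \<Sum>S = (n :: nat)}"
proof (rule finite_subset)
  show "{S \<in> C. \<Sum>S = n} \<subseteq> Pow {..n}"
    using assms by (auto intro: member_le_sum)
qed simp

lemma size_le_sum_mset: "0 \<notin># M \<Longrightarrow> size M \<le> sum_mset (M :: nat multiset)"
  by (induction M) auto

lemma finite_multisets_of_sum:
  assumes "\<And>M. M \<in> C \<Longrightarrow> 0 \<notin># M"
  shows "finite {M \<in> C. sum_mset M = (n :: nat)}"
proof (rule finite_subset)
  show "{M \<in> C. sum_mset M = n} \<subseteq> mset ` {xs. set xs \<subseteq> {..n} \<and> length xs \<le> n}"
  proof
    fix M assume "M \<in> {M \<in> C. sum_mset M = n}"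
    then have M: "0 \<notin># M" "sum_mset M = n"
      using assms by auto
    obtain xs where xs: "mset xs = M"
      by (metis ex_mset)
    have "size M \<le> n"
      using size_le_sum_mset [of M] M by simp
    moreover have "set_mset M \<subseteq> {..n}"
      using M(2) by (auto dest!: multi_member_split)
    ultimately show "M \<in> mset ` {xs. set xs \<subseteq> {..n} \<and> length xs \<le> n}"
      using xs by (auto intro!: image_eqI [of _ _ xs])
  qed
  show "finite (mset ` {xs. set xs \<subseteq> {..n} \<and> length xs \<le> n})"
    by (intro finite_imageI finite_lists_length_le) simp
qed

lemma distinct_gf_insert:
  assumes "k \<notin> A"
  shows "distinct_gf (insert k A) = (1 + fps_X ^ k) * distinct_gf A"
proof -
  let ?C = "{S. finite S \<and> S \<subseteq> A}" and ?D = "{S. finite S \<and> k \<in> S \<and> S \<subseteq> insert k A}"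
  have split: "{S. finite S \<and> S \<subseteq> insert k A} = ?C \<union> ?D"
    by auto
  have "distinct_gf (insert k A) = distinct_gf A + weight_gf (\<lambda>S. \<Sum>S) ?D"
    unfolding distinct_gf_def split
    by (intro weight_gf_Un finite_sets_of_sum) (use assms in blast)+
  also have "weight_gf (\<lambda>S. \<Sum>S) ?D = fps_X ^ k * distinct_gf A"
    unfolding distinct_gf_def
  proof (rule weight_gf_shift)
    show "bij_betw (insert k) ?C ?D"
      by (rule bij_betwI [where g = "\<lambda>S. S - {k}"]) (use assms in auto)
    show "\<Sum>(insert k S) = \<Sum>S + k" if "S \<in> ?C" for S
      using that assms by (subst sum.insert) auto
  qed
  finally show ?thesis
    by (simp add: algebra_simps)
qed

lemma multi_gf_containing:
  assumes "k \<in> A"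
  shows "weight_gf sum_mset {M. set_mset M \<subseteq> A \<and> k \<in># M} = fps_X ^ k * multi_gf A"
  unfolding multi_gf_def
proof (rule weight_gf_shift)
  show "bij_betw (add_mset k) {M. set_mset M \<subseteq> A} {M. set_mset M \<subseteq> A \<and> k \<in># M}"
    by (rule bij_betwI [where g = "\<lambda>M. M - {#k#}"]) (use assms in \<open>auto dest: in_diffD\<close>)
qed simp

lemma multi_gf_insert:
  assumes "k \<notin> A" "k > 0" "0 \<notin> A"
  shows "(1 - fps_X ^ k) * multi_gf (insert k A) = multi_gf A"
proof -
  let ?D = "{M. set_mset M \<subseteq> insert k A \<and> k \<in># M}"
  have split: "{M. set_mset M \<subseteq> insert k A} = {M. set_mset M \<subseteq> A} \<union> ?D"
    by auto
  have "multi_gf (insert k A) = multi_gf A + weight_gf sum_mset ?D"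
    unfolding multi_gf_def split
    by (intro weight_gf_Un finite_multisets_of_sum) (use assms in blast)+
  then show ?thesis
    by (simp add: multi_gf_containing algebra_simps)
qed

lemma distinct_gf_nth_cong:
  assumes "A \<inter> {..n} = B \<inter> {..n}" "i \<le> n"
  shows "distinct_gf A $ i = distinct_gf B $ i"
proof -
  have "S \<subseteq> {..n}" if "finite S" "\<Sum>S = i" for S
    using that assms(2) member_le_sum [of _ S "\<lambda>x. x"] by fastforce
  then have "{S \<in> {S. finite S \<and> S \<subseteq> A}. \<Sum>S = i} = {S \<in> {S. finite S \<and> S \<subseteq> B}. \<Sum>S = i}"
    using assms(1) by blast
  then show ?thesis
    by (simp only: distinct_gf_def weight_gf_nth)
qed

lemma multi_gf_nth_cong:
  assumes "A \<inter> {..n} = B \<inter> {..n}" "i \<le> n"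
  shows "multi_gf A $ i = multi_gf B $ i"
proof -
  have "set_mset M \<subseteq> {..n}" if "sum_mset M = i" for M
    using that assms(2) by (auto dest!: multi_member_split)
  then have "{M \<in> {M. set_mset M \<subseteq> A}. sum_mset M = i} = {M \<in> {M. set_mset M \<subseteq> B}. sum_mset M = i}"
    using assms(1) by blast
  then show ?thesis
    by (simp only: multi_gf_def weight_gf_nth)
qed

text \<open>For a single part \<open>a\<close> this is \<open>(1 + X^a) / (1 - X^(2a)) = 1 / (1 - X^a)\<close>; induction multiplies
  these factors over a finite set, and every coefficient sees only finitely many parts.\<close>

lemma distinct_gf_mult_multi_gf_doubled:
  assumes "0 \<notin> A"
  shows "distinct_gf A * multi_gf ((*) 2 ` A) = multi_gf A"
proof -
  have fin: "distinct_gf B * multi_gf ((*) 2 ` B) = multi_gf B" if "finite B" "0 \<notin> B" for B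
    using that
  proof (induction B rule: finite_induct)
    case empty
    have "{S \<in> {S. finite S \<and> S \<subseteq> {}}. \<Sum>S = n} = (if n = 0 then {{}} else {})" for n :: nat
      by auto
    then have "distinct_gf {} = 1"
      unfolding distinct_gf_def by (intro fps_ext) (simp only: weight_gf_nth, simp)
    then show ?case
      by simp
  next
    case (insert a B)
    have *: "2 * a \<notin> (*) 2 ` B" "0 \<notin> (*) 2 ` B" "a > 0" "0 \<notin> B"
      using insert by auto
    have "(1 - fps_X ^ (2 * a)) * (distinct_gf (insert a B) * multi_gf ((*) 2 ` insert a B))
        = (1 + fps_X ^ a) * distinct_gf B * multi_gf ((*) 2 ` B)"
      using multi_gf_insert [of "2 * a" "(*) 2 ` B"] * insert(2)
      by (simp add: distinct_gf_insert mult.left_commute)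
    also have "\<dots> = (1 + fps_X ^ a) * ((1 - fps_X ^ a) * multi_gf (insert a B))"
      using insert * by (simp add: multi_gf_insert mult.assoc)
    also have "\<dots> = (1 - fps_X ^ (2 * a)) * multi_gf (insert a B)"
      unfolding mult_2 power_add by (simp add: algebra_simps)
    finally show ?case
      using one_minus_fps_X_power_nonzero [of "2 * a"] * by simp
  qed
  show ?thesis
  proof (rule fps_ext)
    fix n
    let ?B = "A \<inter> {..n}"
    have "(distinct_gf A * multi_gf ((*) 2 ` A)) $ n = (distinct_gf ?B * multi_gf ((*) 2 ` ?B)) $ n"
      by (intro fps_mult_nth_cong distinct_gf_nth_cong [of _ n] multi_gf_nth_cong [of _ n]) auto
    also have "\<dots> = multi_gf ?B $ n"
      using assms by (subst fin) auto
    also have "\<dots> = multi_gf A $ n"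
      by (rule multi_gf_nth_cong [of _ n]) auto
    finally show "(distinct_gf A * multi_gf ((*) 2 ` A)) $ n = multi_gf A $ n" .
  qed
qed

lemma multi_gf_Un:
  assumes "0 \<notin> A" "0 \<notin> B" "A \<inter> B = {}"
  shows "multi_gf A * multi_gf B = multi_gf (A \<union> B)"
proof -
  have fin: "multi_gf A * multi_gf B = multi_gf (A \<union> B)" if "finite B" "0 \<notin> B" "A \<inter> B = {}" for B
    using that
  proof (induction B rule: finite_induct)
    case empty
    have "{M. M = {#} \<and> sum_mset M = n} = (if n = 0 then {{#}} else {})" for n :: nat
      by auto
    then have "multi_gf {} = 1"
      by (intro fps_ext) (simp add: multi_gf_def weight_gf_nth)
    then show ?case
      by simp
  next
    case (insert b B)
    have "(1 - fps_X ^ b) * (multi_gf A * multi_gf (insert b B)) = multi_gf A * multi_gf B"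
      using insert by (simp add: multi_gf_insert mult.left_commute)
    also have "\<dots> = (1 - fps_X ^ b) * multi_gf (insert b (A \<union> B))"
      using insert assms(1) by (subst multi_gf_insert) auto
    finally show ?case
      using one_minus_fps_X_power_nonzero [of b] insert by simp
  qed
  show ?thesis
  proof (rule fps_ext)
    fix n
    let ?B = "B \<inter> {..n}"
    have "(multi_gf A * multi_gf B) $ n = (multi_gf A * multi_gf ?B) $ n"
      by (intro fps_mult_nth_cong multi_gf_nth_cong [of _ n]) auto
    also have "\<dots> = multi_gf (A \<union> ?B) $ n"
      using assms by (subst fin) auto
    also have "\<dots> = multi_gf (A \<union> B) $ n"
      by (rule multi_gf_nth_cong [of _ n]) auto
    finally show "(multi_gf A * multi_gf B) $ n = multi_gf (A \<union> B) $ n" .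
  qed
qed

text \<open>Multiplied by the series of partitions into even parts, both sides become the series of all
  partitions: the left one by doubling, the right one by splitting off the even parts.\<close>

lemma euler_odd_distinct: "distinct_gf {1..} = multi_gf {k. odd k}"
proof -
  let ?E = "(*) 2 ` {1 :: nat..}"
  have U: "{k. odd k} \<union> ?E = {1..}"
  proof (intro subset_antisym subsetI)
    fix k :: nat assume "k \<in> {1..}"
    moreover have "k \<in> ?E" if "even k" "k \<ge> 1"
      by (rule image_eqI [of _ _ "k div 2"]) (use that in \<open>simp; presburger\<close>)+
    ultimately show "k \<in> {k. odd k} \<union> ?E"
      by blast
  next
    fix k :: nat assume "k \<in> {k. odd k} \<union> ?E"
    then have "odd k \<or> (\<exists>j\<ge>1. k = 2 * j)"
      by blast
    then show "k \<in> {1..}"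
      by (simp, presburger)
  qed
  have "multi_gf {k. odd k} * multi_gf ?E = multi_gf ({k. odd k} \<union> ?E)"
    by (rule multi_gf_Un) auto
  also have "\<dots> = multi_gf {1..}"
    by (simp only: U)
  finally have odds: "multi_gf {k. odd k} * multi_gf ?E = multi_gf {1..}" .
  have "distinct_gf {1..} * multi_gf ?E = multi_gf {1..}"
    by (rule distinct_gf_mult_multi_gf_doubled) simp
  with odds have "distinct_gf {1..} * multi_gf ?E = multi_gf {k. odd k} * multi_gf ?E"
    by (simp only:)
  moreover have "multi_gf ?E \<noteq> 0"
  proof
    assume "multi_gf ?E = 0"
    with odds have "multi_gf {1..} $ 0 = 0"
      by (simp only: mult_zero_right fps_zero_nth)
    moreover have "{M \<in> {M. set_mset M \<subseteq> {1 :: nat..}}. sum_mset M = 0} = {{#}}"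
    proof -
      have "M = {#}" if "set_mset M \<subseteq> {1 :: nat..}" "sum_mset M = 0" for M
        using that by (cases M) auto
      then show ?thesis by auto
    qed
    ultimately show False
      unfolding multi_gf_def weight_gf_nth by simp
  qed
  ultimately show ?thesis
    by simp
qed

lemma multi_gf_odd_eq: "multi_gf {k. odd k} = (1 + fps_X) * distinct_gf {2..}"
proof -
  have "{1 :: nat..} = insert 1 {2..}"
    by auto
  then show ?thesis
    using distinct_gf_insert [of 1 "{2..}"] euler_odd_distinct by simp
qed

text \<open>By \<open>multi_gf_odd_eq\<close>, dropping 1 from the odd parts multiplies \<open>distinct_gf {2..}\<close> by
  \<open>(1 - X) (1 + X) = 1 - X^2\<close>, and this is the factor that adding 2 as a part divides out again.\<close>

lemma distinct_gf_from_2: "distinct_gf {2..} = multi_gf (insert 2 {k. odd k \<and> 3 \<le> k})"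
proof -
  let ?H = "{k :: nat. odd k \<and> 3 \<le> k}"
  have odds: "{k :: nat. odd k} = insert 1 ?H"
  proof -
    have "k = 1 \<or> 3 \<le> k" if "odd k" for k :: nat
      using that by presburger
    then show ?thesis by auto
  qed
  have "(1 - fps_X) * ((1 + fps_X) * distinct_gf {2..}) = multi_gf ?H"
    unfolding multi_gf_odd_eq [symmetric] using multi_gf_insert [of 1 ?H] odds by simp
  then have "(1 - fps_X ^ 2) * distinct_gf {2..} = (1 - fps_X ^ 2) * multi_gf (insert 2 ?H)"
    by (subst multi_gf_insert) (auto simp: algebra_simps power2_eq_square)
  then show ?thesis
    using one_minus_fps_X_power_nonzero [of 2] by simp
qed

section \<open>Gaps of size two\<close>

text \<open>The lower end \<open>k\<close> of a gap of size two. The value \<open>k = 0\<close> represents the part 0 that follows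
  the last part, so that a smallest part 2 counts as a gap.\<close>

definition gap2 :: "nat set \<Rightarrow> nat \<Rightarrow> bool" where
  "gap2 S k \<longleftrightarrow> k + 2 \<in> S \<and> k + 1 \<notin> S \<and> (k \<in> S \<or> k = 0)"

text \<open>An index counted by \<open>ell2\<close> is the last occurrence of its part, hence is determined by the part
  that follows it, which is the lower end of the gap.\<close>

lemma ell2_eq_card_gap2:
  assumes sorted: "sorted_wrt (\<ge>) xs" and pos: "\<forall>x\<in>set xs. 0 < x"
  shows "ell2 xs = card {k. gap2 (set xs) k}"
proof -
  let ?I = "{i. i < length xs \<and> Defs.part xs i - Defs.part xs (Suc i) = 2}"
  have mono: "Defs.part xs j \<le> Defs.part xs i" if "i \<le> j" for i j
    using that sorted by (cases "i = j"; cases "j < length xs") (auto simp: Defs.part_def sorted_wrt_iff_nth_less le_less)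
  have "bij_betw (\<lambda>i. Defs.part xs (Suc i)) ?I {k. gap2 (set xs) k}"
    unfolding bij_betw_def
  proof (intro conjI subset_antisym subsetI)
    show "inj_on (\<lambda>i. Defs.part xs (Suc i)) ?I"
    proof (rule inj_onI)
      fix i j assume ij: "i \<in> ?I" "j \<in> ?I" "Defs.part xs (Suc i) = Defs.part xs (Suc j)"
      show "i = j"
      proof (rule ccontr)
        assume "i \<noteq> j"
        then consider "Suc i \<le> j" | "Suc j \<le> i" by linarith
        then show False
          using ij mono [of "Suc i" j] mono [of "Suc j" i] by cases auto
      qed
    qed
  next
    fix k assume "k \<in> (\<lambda>i. Defs.part xs (Suc i)) ` ?I"
    then obtain i where i: "i < length xs" "Defs.part xs i = k + 2" "Defs.part xs (Suc i) = k"
      by auto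
    have "k + 1 \<noteq> xs ! j" if "j < length xs" for j
    proof -
      have "Defs.part xs j = xs ! j"
        using that by (simp add: Defs.part_def)
      then show ?thesis
        using mono [of j i] mono [of "Suc i" j] i by (cases "j \<le> i") auto
    qed
    then have "k + 1 \<notin> set xs"
      by (metis in_set_conv_nth)
    then show "k \<in> {k. gap2 (set xs) k}"
      using i nth_mem [of i xs] by (auto simp: gap2_def Defs.part_def split: if_splits)
  next
    fix k assume "k \<in> {k. gap2 (set xs) k}"
    then have k: "k + 2 \<in> set xs" "k + 1 \<notin> set xs" "k \<in> set xs \<or> k = 0"
      by (auto simp: gap2_def)
    \<comment> \<open>Only the last occurrence of \<open>k + 2\<close> is followed by a smaller part.\<close>
    define i where "i = Max {i. i < length xs \<and> xs ! i = k + 2}"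
    have ne: "{i. i < length xs \<and> xs ! i = k + 2} \<noteq> {}"
      using k(1) by (auto simp: in_set_conv_nth)
    then have i: "i < length xs" "xs ! i = k + 2"
      using Max_in [OF _ ne] by (auto simp: i_def)
    have max: "j \<le> i" if "j < length xs" "xs ! j = k + 2" for j
      unfolding i_def by (rule Max_ge) (use that in auto)
    have "Defs.part xs (Suc i) \<le> k + 2"
      using mono [of i "Suc i"] i by (simp add: Defs.part_def)
    moreover have "Defs.part xs (Suc i) \<noteq> k + 2"
      using max [of "Suc i"] by (auto simp: Defs.part_def)
    moreover have "Defs.part xs (Suc i) \<noteq> k + 1"
      using k pos by (auto simp: Defs.part_def dest: nth_mem)
    moreover have "k \<le> Defs.part xs (Suc i)"
    proof (cases "k = 0")
      case False
      then obtain j where j: "j < length xs" "xs ! j = k"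
        using k(3) by (auto simp: in_set_conv_nth)
      then have "Suc i \<le> j"
        using mono [of j i] i by (cases "Suc i \<le> j") (auto simp: Defs.part_def)
      then show ?thesis
        using mono [of "Suc i" j] j by (simp add: Defs.part_def)
    qed simp
    ultimately have "Defs.part xs (Suc i) = k"
      by linarith
    then show "k \<in> (\<lambda>i. Defs.part xs (Suc i)) ` ?I"
      using i by (intro image_eqI [of _ _ i]) (auto simp: Defs.part_def)
  qed
  then show ?thesis
    by (simp add: ell2_def bij_betw_same_card)
qed

lemma sorted_wrt_ge_iff: "sorted_wrt (\<ge>) xs \<longleftrightarrow> sorted (rev (xs :: nat list))"
  by (simp add: sorted_wrt_rev)

lemma bij_betw_set_distinct_partitions:
  "bij_betw set (distinct_partitions n) {S. (finite S \<and> S \<subseteq> {1..}) \<and> \<Sum>S = n}"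
proof (rule bij_betwI [where g = "\<lambda>S. rev (sorted_list_of_set S)"])
  show "set \<in> distinct_partitions n \<rightarrow> {S. (finite S \<and> S \<subseteq> {1..}) \<and> \<Sum>S = n}"
    by (auto simp: distinct_partitions_def partitions_def distinct_sum_list_conv_Sum Suc_le_eq)
  show "(\<lambda>S. rev (sorted_list_of_set S)) \<in> {S. (finite S \<and> S \<subseteq> {1..}) \<and> \<Sum>S = n} \<rightarrow> distinct_partitions n"
    by (auto simp: distinct_partitions_def partitions_def sorted_wrt_ge_iff rev_swap
        distinct_sum_list_conv_Sum Suc_le_eq)
  show "rev (sorted_list_of_set (set xs)) = xs" if "xs \<in> distinct_partitions n" for xs
  proof -
    have "sorted_list_of_set (set (rev xs)) = rev xs"
      by (rule sorted_list_of_set.idem_if_sorted_distinct)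
        (use that in \<open>auto simp: distinct_partitions_def partitions_def sorted_wrt_ge_iff\<close>)
    then show ?thesis by simp
  qed
qed auto

lemma bij_betw_mset_odd_partitions:
  "bij_betw mset (odd_partitions n) {M. set_mset M \<subseteq> {k. odd k} \<and> sum_mset M = n}"
proof (rule bij_betwI [where g = "\<lambda>M. rev (sorted_list_of_multiset M)"])
  show "mset \<in> odd_partitions n \<rightarrow> {M. set_mset M \<subseteq> {k. odd k} \<and> sum_mset M = n}"
    by (auto simp: odd_partitions_def partitions_def sum_mset_sum_list)
  show "(\<lambda>M. rev (sorted_list_of_multiset M)) \<in> {M. set_mset M \<subseteq> {k. odd k} \<and> sum_mset M = n} \<rightarrow> odd_partitions n"
    by (auto simp: odd_partitions_def partitions_def sorted_wrt_ge_iff odd_pos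
        simp flip: sum_mset_sum_list)
  show "rev (sorted_list_of_multiset (mset xs)) = xs" if "xs \<in> odd_partitions n" for xs
  proof -
    have "sort (rev xs) = rev xs"
      by (rule sorted_sort_id)
        (use that in \<open>auto simp: odd_partitions_def partitions_def sorted_wrt_ge_iff\<close>)
    moreover have "sort (rev xs) = sort xs"
      by (rule properties_for_sort) auto
    ultimately show ?thesis by (simp add: sorted_list_of_multiset_mset)
  qed
qed auto

definition distinct_ell2_gf :: "int fps" where
  "distinct_ell2_gf = Abs_fps (\<lambda>n. \<Sum>xs\<in>distinct_partitions n. int (ell2 xs))"

definition odd_ell2_gf :: "int fps" where
  "odd_ell2_gf = Abs_fps (\<lambda>n. \<Sum>xs\<in>odd_partitions n. int (ell2 xs))"

lemma distinct_ell2_gf_nth: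
  assumes "n < N"
  shows "distinct_ell2_gf $ n
    = (\<Sum>k<N. weight_gf (\<lambda>S. \<Sum>S) {S \<in> {S. finite S \<and> S \<subseteq> {1..}}. gap2 S k}) $ n"
proof -
  have "distinct_ell2_gf $ n
      = (\<Sum>xs\<in>distinct_partitions n. int (card {k. gap2 (set xs) k}))"
    by (simp add: distinct_ell2_gf_def)
      (intro sum.cong refl arg_cong [where f = int] ell2_eq_card_gap2;
       auto simp: distinct_partitions_def partitions_def)
  also have "\<dots> = (\<Sum>S | (finite S \<and> S \<subseteq> {1..}) \<and> \<Sum>S = n. int (card {k. gap2 S k}))"
    by (rule sum.reindex_bij_betw [OF bij_betw_set_distinct_partitions])
  also have "\<dots> = (\<Sum>S | S \<in> {S. finite S \<and> S \<subseteq> {1..}} \<and> \<Sum>S = n. int (card {k. gap2 S k}))"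
    by simp
  also have "\<dots> = (\<Sum>k<N. weight_gf (\<lambda>S. \<Sum>S) {S \<in> {S. finite S \<and> S \<subseteq> {1..}}. gap2 S k}) $ n"
  proof (rule sum_card_eq_weight_gf_nth)
    fix S k assume "S \<in> {S. finite S \<and> S \<subseteq> {1..}}" "\<Sum>S = n" "gap2 S k"
    then show "k < N"
      using member_le_sum [of "k + 2" S "\<lambda>x. x"] assms by (simp add: gap2_def)
  qed (rule finite_sets_of_sum, simp)
  finally show ?thesis .
qed

lemma odd_ell2_gf_nth:
  assumes "n < N"
  shows "odd_ell2_gf $ n
    = (\<Sum>k<N. weight_gf sum_mset {M \<in> {M. set_mset M \<subseteq> {k. odd k}}. gap2 (set_mset M) k}) $ n"
proof -
  have "odd_ell2_gf $ n
      = (\<Sum>xs\<in>odd_partitions n. int (card {k. gap2 (set_mset (mset xs)) k}))"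
    unfolding set_mset_mset
    by (simp add: odd_ell2_gf_def)
      (intro sum.cong refl arg_cong [where f = int] ell2_eq_card_gap2;
       auto simp: odd_partitions_def partitions_def)
  also have "\<dots> = (\<Sum>M | set_mset M \<subseteq> {k. odd k} \<and> sum_mset M = n. int (card {k. gap2 (set_mset M) k}))"
    by (rule sum.reindex_bij_betw [OF bij_betw_mset_odd_partitions])
  also have "\<dots> = (\<Sum>M | M \<in> {M. set_mset M \<subseteq> {k. odd k}} \<and> sum_mset M = n.
      int (card {k. gap2 (set_mset M) k}))"
    by simp
  also have "\<dots> = (\<Sum>k<N. weight_gf sum_mset {M \<in> {M. set_mset M \<subseteq> {k. odd k}}. gap2 (set_mset M) k}) $ n"
  proof (rule sum_card_eq_weight_gf_nth)
    show "finite {M \<in> {M. set_mset M \<subseteq> {k. odd k}}. sum_mset M = n}"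
      by (rule finite_multisets_of_sum) auto
    fix M k assume "M \<in> {M. set_mset M \<subseteq> {k. odd k}}" "sum_mset M = n" "gap2 (set_mset M) k"
    then show "k < N"
      using assms by (auto simp: gap2_def dest!: multi_member_split)
  qed
  finally show ?thesis .
qed

lemma distinct_gap2_0:
  "weight_gf (\<lambda>S. \<Sum>S) {S \<in> {S. finite S \<and> S \<subseteq> {1..}}. gap2 S 0} = fps_X ^ 2 * distinct_gf {3..}"
  unfolding distinct_gf_def
proof (rule weight_gf_shift)
  have *: "x \<ge> Suc (Suc (Suc 0))" if "x \<ge> Suc 0" "x \<noteq> Suc 0" "x \<noteq> Suc (Suc 0)" for x
    using that by linarith
  show "bij_betw (insert 2) {S. finite S \<and> S \<subseteq> {3 :: nat..}} {S \<in> {S. finite S \<and> S \<subseteq> {1..}}. gap2 S 0}"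
    by (rule bij_betwI [where g = "\<lambda>S. S - {2}"])
      (auto simp: gap2_def numeral_2_eq_2 numeral_3_eq_3 intro: *)
  show "\<Sum>(insert 2 S) = \<Sum>S + 2" if "S \<in> {S. finite S \<and> S \<subseteq> {3 :: nat..}}" for S
    using that by (subst sum.insert) auto
qed

lemma distinct_gap2_pos:
  assumes "k > 0"
  shows "weight_gf (\<lambda>S. \<Sum>S) {S \<in> {S. finite S \<and> S \<subseteq> {1..}}. gap2 S k}
    = fps_X ^ (2 * k + 2) * distinct_gf ({1..} - {k, k + 1, k + 2})"
  unfolding distinct_gf_def
proof (rule weight_gf_shift)
  let ?D = "{S. finite S \<and> S \<subseteq> {1..} - {k, k + 1, k + 2}}"
  show "bij_betw (\<lambda>S. insert k (insert (k + 2) S)) ?D {S \<in> {S. finite S \<and> S \<subseteq> {1..}}. gap2 S k}"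
    by (rule bij_betwI [where g = "\<lambda>S. S - {k, k + 2}"]) (use assms in \<open>auto simp: gap2_def\<close>)
  show "\<Sum>(insert k (insert (k + 2) S)) = \<Sum>S + (2 * k + 2)" if "S \<in> ?D" for S
  proof -
    have "finite S" "k \<notin> S" "k + 2 \<notin> S"
      using that by auto
    then show ?thesis by simp
  qed
qed

lemma odd_gap2:
  "weight_gf sum_mset {M \<in> {M. set_mset M \<subseteq> {k. odd k}}. gap2 (set_mset M) k}
    = (if odd k then fps_X ^ (2 * k + 2) * multi_gf {k. odd k} else 0)"
proof (cases "odd k")
  case True
  have "weight_gf sum_mset {M \<in> {M. set_mset M \<subseteq> {k. odd k}}. gap2 (set_mset M) k}
      = fps_X ^ (2 * k + 2) * multi_gf {k. odd k}"
    unfolding multi_gf_def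
  proof (rule weight_gf_shift)
    show "bij_betw (\<lambda>M. add_mset k (add_mset (k + 2) M)) {M. set_mset M \<subseteq> {k. odd k}}
        {M \<in> {M. set_mset M \<subseteq> {k. odd k}}. gap2 (set_mset M) k}"
    proof (rule bij_betwI [where g = "\<lambda>M. M - {#k, k + 2#}"])
      fix M assume M: "M \<in> {M \<in> {M. set_mset M \<subseteq> {k. odd k}}. gap2 (set_mset M) k}"
      then obtain N where N: "M = add_mset (k + 2) N"
        by (auto simp: gap2_def dest: multi_member_split)
      then have "k \<in># N"
        using M True by (auto simp: gap2_def)
      then obtain K where "N = add_mset k K"
        by (auto dest: multi_member_split)
      with N show "add_mset k (add_mset (k + 2) (M - {#k, k + 2#})) = M"
        by simp
    qed (use True in \<open>auto simp: gap2_def dest: in_diffD\<close>)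
  qed simp
  with True show ?thesis by simp
next
  case False
  then have "{M \<in> {M. set_mset M \<subseteq> {k. odd k}}. gap2 (set_mset M) k} = {}"
    by (auto simp: gap2_def)
  then show ?thesis
    using False by (simp only:) (simp add: weight_gf_def fps_eq_iff)
qed

text \<open>Let \<open>U k\<close> and \<open>V k\<close> count the sets that avoid \<open>{k, k + 1}\<close> and \<open>{k, k + 1, k + 2}\<close>. Since
  \<open>U k = (1 + X^(k+2)) V k\<close> and \<open>U (k + 1) = (1 + X^k) V k\<close>, the difference
  \<open>U k - X^2 U (k + 1)\<close> equals \<open>(1 - X^2) V k\<close>, so the contributions \<open>X^(2k+2) V k\<close> of \<open>k > 0\<close>
  telescope to \<open>X^4 U 1\<close> after multiplication by \<open>1 - X^2\<close>. The contribution of \<open>k = 0\<close> becomes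
  \<open>(1 - X^2) X^2 U 1\<close>, and together they leave \<open>X^2 U 1\<close>. A factor \<open>1 + X^2\<close> finally turns the
  parts at least 3 counted by \<open>U 1\<close> into parts at least 2.\<close>

lemma distinct_ell2_gf_eq: "(1 - fps_X ^ 4) * distinct_ell2_gf = fps_X ^ 2 * distinct_gf {2..}"
proof -
  define G where "G = (\<lambda>k. weight_gf (\<lambda>S. \<Sum>S) {S \<in> {S. finite S \<and> S \<subseteq> {1 :: nat..}}. gap2 S k})"
  define U where "U = (\<lambda>k :: nat. distinct_gf ({1..} - {k, k + 1}))"
  have U1: "U 1 = distinct_gf {3..}"
    unfolding U_def by (rule arg_cong [where f = distinct_gf]) auto
  have G: "(1 - fps_X ^ 2) * G k = fps_X ^ (2 * k + 2) * U k - fps_X ^ (2 * k + 4) * U (k + 1)"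
    if "k > 0" for k
  proof -
    let ?V = "distinct_gf ({1..} - {k, k + 1, k + 2})"
    have "{1..} - {k, k + 1} = insert (k + 2) ({1..} - {k, k + 1, k + 2})"
      "{1..} - {k + 1, k + 1 + 1} = insert k ({1..} - {k, k + 1, k + 2})"
      using that by auto
    then have U: "U k = (1 + fps_X ^ k * fps_X ^ 2) * ?V" "U (k + 1) = (1 + fps_X ^ k) * ?V"
      unfolding U_def power_add [symmetric] by (simp_all only:) (subst distinct_gf_insert; simp)+
    have "G k = fps_X ^ (2 * k + 2) * ?V"
      unfolding G_def by (rule distinct_gap2_pos [OF that])
    moreover have "fps_X ^ (2 * k + 4) = (fps_X ^ (2 * k + 2) * fps_X ^ 2 :: int fps)"
      by (simp add: power_add power2_eq_square power4_eq_xxxx)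
    ultimately show ?thesis
      unfolding U by (simp only: algebra_simps mult_1_left)
  qed
  have G0: "G 0 = fps_X ^ 2 * distinct_gf {3..}"
    unfolding G_def by (rule distinct_gap2_0)
  have tele: "(1 - fps_X ^ 2) * (\<Sum>k<Suc N. G k)
      = fps_X ^ 2 * distinct_gf {3..} - fps_X ^ (2 * N + 4) * U (N + 1)" for N
  proof (induction N)
    case 0
    then show ?case
      using U1 by (simp add: G0 power2_eq_square power4_eq_xxxx algebra_simps)
  next
    case (Suc N)
    have "(1 - fps_X ^ 2) * (\<Sum>k<Suc (Suc N). G k)
        = (1 - fps_X ^ 2) * (\<Sum>k<Suc N. G k) + (1 - fps_X ^ 2) * G (N + 1)"
      by (simp add: distrib_left)
    also have "\<dots> = fps_X ^ 2 * distinct_gf {3..} - fps_X ^ (2 * N + 4) * U (N + 1)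
        + (fps_X ^ (2 * (N + 1) + 2) * U (N + 1) - fps_X ^ (2 * (N + 1) + 4) * U (N + 1 + 1))"
      by (subst G) (simp_all only: Suc)
    also have "2 * (N + 1) + 2 = 2 * N + 4"
      by simp
    finally show ?case
      by simp
  qed
  have "(1 - fps_X ^ 2) * distinct_ell2_gf = fps_X ^ 2 * distinct_gf {3..}"
  proof (rule fps_ext)
    fix n
    have "((1 - fps_X ^ 2) * distinct_ell2_gf) $ n = ((1 - fps_X ^ 2) * (\<Sum>k<Suc n. G k)) $ n"
      unfolding G_def by (intro fps_mult_nth_cong distinct_ell2_gf_nth refl) simp
    also have "\<dots> = (fps_X ^ 2 * distinct_gf {3..}) $ n"
      unfolding tele by (simp add: fps_X_power_mult_nth)
    finally show "((1 - fps_X ^ 2) * distinct_ell2_gf) $ n = (fps_X ^ 2 * distinct_gf {3..}) $ n" .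
  qed
  then have "(1 + fps_X ^ 2) * ((1 - fps_X ^ 2) * distinct_ell2_gf)
      = fps_X ^ 2 * ((1 + fps_X ^ 2) * distinct_gf {3..})"
    by (simp add: mult.left_commute)
  also have "(1 + fps_X ^ 2) * distinct_gf {3..} = distinct_gf {2..}"
  proof -
    have "{2 :: nat..} = insert 2 {3..}" by auto
    then show ?thesis by (simp add: distinct_gf_insert)
  qed
  finally show ?thesis
    by (simp add: algebra_simps numeral_eq_Suc)
qed

lemma odd_ell2_gf_eq: "(1 - fps_X ^ 4) * odd_ell2_gf = fps_X ^ 4 * multi_gf {k. odd k}"
proof -
  define G where "G = (\<lambda>k. weight_gf sum_mset {M \<in> {M. set_mset M \<subseteq> {k. odd k}}. gap2 (set_mset M) k})"
  have tele: "(1 - fps_X ^ 4) * (\<Sum>k<2 * N. G k)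
      = fps_X ^ 4 * multi_gf {k. odd k} - fps_X ^ (4 * N + 4) * multi_gf {k. odd k}" for N
  proof (induction N)
    case (Suc N)
    have "2 * Suc (2 * N) + 2 = 4 * N + 4"
      by simp
    then have "G (2 * N) = 0" "G (Suc (2 * N)) = fps_X ^ (4 * N + 4) * multi_gf {k. odd k}"
      unfolding G_def odd_gap2 by (simp_all only: even_Suc dvd_triv_left not_not if_True if_False simp_thms)
    then have "(1 - fps_X ^ 4) * (\<Sum>k<2 * Suc N. G k)
        = (1 - fps_X ^ 4) * (\<Sum>k<2 * N. G k) + (1 - fps_X ^ 4) * (fps_X ^ (4 * N + 4) * multi_gf {k. odd k})"
      by (simp add: distrib_left)
    also have "\<dots> = fps_X ^ 4 * multi_gf {k. odd k} - fps_X ^ 4 * fps_X ^ (4 * N + 4) * multi_gf {k. odd k}"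
      by (subst Suc) (simp add: left_diff_distrib mult.assoc)
    also have "fps_X ^ 4 * fps_X ^ (4 * N + 4) = (fps_X ^ (4 * Suc N + 4) :: int fps)"
      by (simp flip: power_add)
    finally show ?case .
  qed simp
  show ?thesis
  proof (rule fps_ext)
    fix n
    have "((1 - fps_X ^ 4) * odd_ell2_gf) $ n = ((1 - fps_X ^ 4) * (\<Sum>k<2 * Suc n. G k)) $ n"
      unfolding G_def by (intro fps_mult_nth_cong odd_ell2_gf_nth refl) simp
    also have "\<dots> = (fps_X ^ 4 * multi_gf {k. odd k}) $ n"
      unfolding tele by (simp add: fps_X_power_mult_nth)
    finally show "((1 - fps_X ^ 4) * odd_ell2_gf) $ n = (fps_X ^ 4 * multi_gf {k. odd k}) $ n" .
  qed
qed

section \<open>Sign of the difference\<close>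

text \<open>Trade one part \<open>s\<close> for \<open>(s - 5) div 2\<close> parts 2, which lowers the sum by 5. All other parts are
  odd, so the number of twos in the image recovers \<open>s\<close>, whichever part was chosen. A part to trade
  exists only because the sum is positive.\<close>

lemma multi_gf_odd_ge_5_le:
  assumes "m \<ge> 1"
  shows "multi_gf {k. odd k \<and> 5 \<le> k} $ m \<le> (fps_X ^ 5 * multi_gf (insert 2 {k. odd k \<and> 3 \<le> k})) $ m"
proof -
  let ?W = "{M \<in> {M. set_mset M \<subseteq> {k. odd k \<and> 5 \<le> k}}. sum_mset M = m}"
  let ?T = "{M \<in> {M. set_mset M \<subseteq> insert 2 {k. odd k \<and> 3 \<le> k}}. sum_mset M = m - 5}"
  define s where "s = (\<lambda>M :: nat multiset. SOME x. x \<in># M)"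
  define f where "f = (\<lambda>M. replicate_mset ((s M - 5) div 2) 2 + (M - {#s M#}))"
  have s: "s M \<in># M" "odd (s M)" "5 \<le> s M" if "M \<in> ?W" for M
  proof -
    have "M \<noteq> {#}"
      using that assms by auto
    then have "\<exists>x. x \<in># M"
      by (meson multiset_nonemptyE)
    then show "s M \<in># M"
      unfolding s_def by (rule someI_ex)
    then show "odd (s M)" "5 \<le> s M"
      using that by auto
  qed
  have sm: "s M + sum_mset (M - {#s M#}) = m" if "M \<in> ?W" for M
  proof -
    have "sum_mset (add_mset (s M) (M - {#s M#})) = m"
      unfolding insert_DiffM [OF s(1) [OF that]] using that by simp
    then show ?thesis
      by simp
  qed
  show ?thesis
  proof (cases "m < 5")
    case True
    then have "M \<notin> ?W" for M
      using s(3) [of M] sm [of M] by linarith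
    then have "?W = {}"
      by blast
    with True show ?thesis
      by (simp only: multi_gf_def weight_gf_nth fps_X_power_mult_nth card.empty of_nat_0 if_True)
  next
    case False
    have "card ?W \<le> card ?T"
    proof (rule card_inj_on_le)
      show "f ` ?W \<subseteq> ?T"
      proof (rule image_subsetI)
        fix M assume M: "M \<in> ?W"
        have "2 * ((s M - 5) div 2) = s M - 5"
          using s [OF M] by presburger
        then have "sum_mset (f M) = m - 5"
          using s(3) [OF M] sm [OF M] by (simp add: f_def mult.commute)
        then show "f M \<in> ?T"
          using M by (auto simp: f_def dest: in_diffD split: if_splits)
      qed
      show "inj_on f ?W"
      proof (rule inj_onI)
        fix M N assume M: "M \<in> ?W" and N: "N \<in> ?W" and eq: "f M = f N"
        have no2: "count K 2 = 0" if "K \<in> ?W" for K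
          using that by (auto simp: count_eq_zero_iff)
        have count: "count (f K) 2 = (s K - 5) div 2" if "K \<in> ?W" for K
          using no2 [OF that] by (simp add: f_def)
        have "(s M - 5) div 2 = (s N - 5) div 2"
          using count [OF M] count [OF N] eq by simp
        then have "s M = s N"
          using s [OF M] s [OF N] by presburger
        with eq have "M - {#s M#} = N - {#s M#}"
          by (simp add: f_def)
        then show "M = N"
          using s(1) [OF M] s(1) [OF N] \<open>s M = s N\<close> by (metis insert_DiffM)
      qed
      show "finite ?T"
        by (rule finite_multisets_of_sum) auto
    qed
    with False show ?thesis
      by (simp add: multi_gf_def weight_gf_nth fps_X_power_mult_nth)
  qed
qed

lemma ell2_difference_gf_eq:
  "(1 - fps_X ^ 4) * (odd_ell2_gf - distinct_ell2_gf)
    = fps_X ^ 2 * (fps_X ^ 5 * multi_gf (insert 2 {k. odd k \<and> 3 \<le> k}) - multi_gf {k. odd k \<and> 5 \<le> k})"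
proof -
  define H where "H = {k :: nat. odd k \<and> 3 \<le> k}"
  define W where "W = {k :: nat. odd k \<and> 5 \<le> k}"
  let ?R = "multi_gf (insert 2 H)"
  have R: "distinct_gf {2..} = ?R"
    unfolding H_def by (rule distinct_gf_from_2)
  have O: "multi_gf {k. odd k} = (1 + fps_X) * ?R"
    by (simp only: multi_gf_odd_eq R)
  have "k = 3 \<or> 5 \<le> k" if "odd k" "3 \<le> k" for k :: nat
    using that by presburger
  then have "H = insert 3 W"
    by (auto simp: H_def W_def)
  moreover have "(1 - fps_X ^ 3) * multi_gf (insert 3 W) = multi_gf W"
    by (rule multi_gf_insert) (auto simp: W_def)
  moreover have "(1 - fps_X ^ 2) * ?R = multi_gf H"
    by (rule multi_gf_insert) (auto simp: H_def)
  ultimately have W: "multi_gf W = (1 - fps_X ^ 3) * ((1 - fps_X ^ 2) * ?R)"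
    by simp
  have "(1 - fps_X ^ 4) * (odd_ell2_gf - distinct_ell2_gf) = fps_X ^ 4 * ((1 + fps_X) * ?R) - fps_X ^ 2 * ?R"
    by (simp only: right_diff_distrib odd_ell2_gf_eq distinct_ell2_gf_eq O R)
  also have "\<dots> = fps_X ^ 2 * (fps_X ^ 5 * ?R - multi_gf W)"
    unfolding W by (simp add: algebra_simps numeral_eq_Suc)
  finally show ?thesis
    by (simp only: H_def W_def)
qed

theorem theorem6p2:
  fixes n :: nat
  defines "d \<equiv> (\<Sum>xs\<in>odd_partitions n. int (ell2 xs)) - (\<Sum>xs\<in>distinct_partitions n. int (ell2 xs))"
  shows "(n \<noteq> 2 \<and> n \<noteq> 6 \<longrightarrow> d \<ge> 0) \<and> (n = 2 \<or> n = 6 \<longrightarrow> d = - 1)"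
proof -
  define D where "D = odd_ell2_gf - distinct_ell2_gf"
  let ?R = "multi_gf (insert 2 {k. odd k \<and> 3 \<le> k})" and ?W = "multi_gf {k. odd k \<and> 5 \<le> k}"
  define e where "e = fps_X ^ 5 * ?R - ?W"
  have d: "d = D $ n"
    by (simp add: d_def D_def odd_ell2_gf_def distinct_ell2_gf_def)
  have rec: "D $ m = (if m < 4 then 0 else D $ (m - 4)) + (if m < 2 then 0 else e $ (m - 2))" for m
  proof -
    have "((1 - fps_X ^ 4) * D) $ m = (fps_X ^ 2 * e) $ m"
      unfolding D_def e_def ell2_difference_gf_eq ..
    then show ?thesis
      by (simp add: left_diff_distrib fps_X_power_mult_nth split: if_splits)
  qed
  have e_nonneg: "e $ m \<ge> 0" if "m \<ge> 1" for m
    using multi_gf_odd_ge_5_le [OF that] by (simp add: e_def)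
  have W0: "?W $ 0 = 1"
  proof -
    have "M = {#}" if "set_mset M \<subseteq> {k. odd k \<and> 5 \<le> k}" "sum_mset M = 0" for M :: "nat multiset"
      using that by (cases M) auto
    then have "{M \<in> {M. set_mset M \<subseteq> {k. odd k \<and> 5 \<le> k}}. sum_mset M = (0 :: nat)} = {{#}}"
      by auto
    then show ?thesis
      unfolding multi_gf_def weight_gf_nth by simp
  qed
  \<comment> \<open>One odd part is never 4 or 8, and two parts at least 5 already exceed 8.\<close>
  have W48: "?W $ m = 0" if "m = 4 \<or> m = 8" for m
  proof -
    have "sum_mset M \<noteq> m" if M: "set_mset M \<subseteq> {k. odd k \<and> 5 \<le> k}" for M
    proof (cases M)
      case (add x N)
      then show ?thesis
      proof (cases N)
        case (add y K)
        then show ?thesis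
          using M \<open>M = add_mset x N\<close> \<open>m = 4 \<or> m = 8\<close> by auto
      qed (use M \<open>m = 4 \<or> m = 8\<close> in auto)
    qed (use \<open>m = 4 \<or> m = 8\<close> in auto)
    then have "{M \<in> {M. set_mset M \<subseteq> {k. odd k \<and> 5 \<le> k}}. sum_mset M = m} = {}"
      by blast
    then show ?thesis
      by (simp only: multi_gf_def weight_gf_nth card.empty of_nat_0)
  qed
  have R3: "?R $ 3 \<ge> 1"
  proof -
    let ?C = "{M \<in> {M. set_mset M \<subseteq> insert 2 {k. odd k \<and> 3 \<le> k}}. sum_mset M = (3 :: nat)}"
    have "finite ?C"
      by (rule finite_multisets_of_sum) auto
    moreover have "{#3#} \<in> ?C"
      by simp
    ultimately have "card ?C > 0"
      using card_gt_0_iff by blast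
    then show ?thesis
      by (simp add: multi_gf_def weight_gf_nth)
  qed
  have e: "e $ 0 = -1" "e $ 4 = 0" "e $ 8 \<ge> 1"
    using W0 W48 R3 by (simp_all add: e_def fps_X_power_mult_nth)
  have D2: "D $ 2 = -1"
    using rec [of 2] e by simp
  have D6: "D $ 6 = -1"
    using rec [of 6] D2 e by simp
  have "D $ m \<ge> 0" if "m \<noteq> 2" "m \<noteq> 6" for m
    using that
  proof (induction m rule: less_induct)
    case (less m)
    show ?case
    \<comment> \<open>Among the remaining degrees only 10 has an exceptional predecessor in steps of 4.\<close>
    proof (cases "m = 10")
      case True
      then show ?thesis
        using rec [of 10] D6 e by simp
    next
      case False
      then show ?thesis
        using less rec [of m] e_nonneg [of "m - 2"] by (cases "m < 4") auto
    qed
  qed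
  then show ?thesis
    using d D2 D6 by auto
qed

end
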